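(* Let $G$ be a finite simple graph on the vertex set $[n]$ with Laplacian $L_G$, and let $f_G(t):=\det(I+D(t)L_G)\in\mathcal{A}_n$, where $D(t)=\operatorname{diag}(t_1,\dots,t_n)$. Write $\log f_G=\sum_{\varnothing\ne S\subseteq[n]}\kappa_S(G)\,t^S$. Then: (i) $\kappa_{\{i\}}(G)=\deg_G(i)$ for every $i\in[n]$. (ii) For every $S\subseteq[n]$ with $|S|\ge2$, $\kappa_S(G)=-h(G[S])$, where $h(G[S])$ is the number of oriented Hamiltonian cycles, modulo rotation, in the induced subgraph $G[S]$. In particular, for $|S|=2$, $\kappa_{\{i,j\}}(G)=-1$ if $ij\in E(G)$ and $0$ otherwise. In particular, $\kappa_S(G)\le0$ for all $|S|\ge2$.
   Context: $[n]=\{1,\dots,n\}$. The squarefree algebra $\mathcal{A}_n:=\mathbb{R}[t_1,\dots,t_n]/(t_1^2,\dots,t_n^2)$ has basis $\{t^S: S\subseteq[n]\}$ with $t^S:=\prod_{i\in S}t_i$, $t^\varnothing=1$. For $f\in\mathcal{A}_n$ with constant term $1$, $\log f:=\sum_{k=1}^n\frac{(-1)^{k+1}}{k}(f-1)^k$ (a terminating series, since $f-1$ is nilpotent). The Laplacian is $L_G=$ (diagonal degree matrix) $-$ (adjacency matrix). The determinant is computed for matrices over the commutative ring $\mathcal{A}_n$. Oriented Hamiltonian cycles modulo rotation: for $|S|=k\ge2$, $h(G[S])$ is the number of orderings $(i_1,\dots,i_k)$ of the elements of $S$, taken modulo cyclic rotation, such that $i_1i_2,\,i_2i_3,\dots,i_{k-1}i_k,\,i_ki_1$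 are all edges of $G$. The two directions of traversal count separately when $k\ge3$; for $k=2$ a Hamiltonian cycle on two vertices is a single directed $2$-cycle, so $h=1$ if the two vertices are adjacent and $h=0$ otherwise. *)

theory Defs
  imports "HOL-Analysis.Analysis" "HOL-Library.Poly_Mapping"
begin

text \<open>
  The index set [n] is a finite type \<open>'n\<close> with \<open>n = CARD('n)\<close>. Polynomials in the
  variables \<open>t\<^sub>i\<close>, \<open>i :: 'n\<close>, are finitely supported functions from exponent vectors
  \<open>'n \<Rightarrow>\<^sub>0 nat\<close> to real coefficients, with the convolution product of
  \<^theory>\<open>HOL-Library.Poly_Mapping\<close>.
\<close>

type_synonym 'n rpoly = "('n \<Rightarrow>\<^sub>0 nat) \<Rightarrow>\<^sub>0 real"

definition pvar :: "'n \<Rightarrow> 'n rpoly" where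
  "pvar i = Poly_Mapping.single (Poly_Mapping.single i 1) 1"

definition sq_ideal :: "('n::finite) rpoly set" where
  "sq_ideal = {p. \<exists>q. p = (\<Sum>i\<in>UNIV. q i * pvar i ^ 2)}"

definition sq_cong :: "('n::finite) rpoly \<Rightarrow> 'n rpoly \<Rightarrow> bool" where
  "sq_cong p q \<longleftrightarrow> p - q \<in> sq_ideal"

lemma sq_ideal_zero: "0 \<in> sq_ideal"
  unfolding sq_ideal_def by (auto intro!: exI[of _ "\<lambda>_. 0"])

lemma sq_ideal_add:
  assumes "p \<in> sq_ideal" "q \<in> sq_ideal" shows "p + q \<in> sq_ideal"
proof -
  obtain a b where "p = (\<Sum>i\<in>UNIV. a i * pvar i ^ 2)" "q = (\<Sum>i\<in>UNIV. b i * pvar i ^ 2)"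
    using assms unfolding sq_ideal_def by blast
  then have "p + q = (\<Sum>i\<in>UNIV. (a i + b i) * pvar i ^ 2)"
    by (simp add: sum.distrib distrib_right)
  then show ?thesis unfolding sq_ideal_def by (intro CollectI exI)
qed

lemma sq_ideal_mult:
  assumes "p \<in> sq_ideal" shows "r * p \<in> sq_ideal"
proof -
  obtain a where "p = (\<Sum>i\<in>UNIV. a i * pvar i ^ 2)"
    using assms unfolding sq_ideal_def by blast
  then have "r * p = (\<Sum>i\<in>UNIV. (r * a i) * pvar i ^ 2)"
    by (simp add: sum_distrib_left mult.assoc)
  then show ?thesis unfolding sq_ideal_def by (intro CollectI exI)
qed

lemma sq_ideal_uminus: "p \<in> sq_ideal \<Longrightarrow> - p \<in> sq_ideal"
  using sq_ideal_mult[of p "- 1"] by simp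

lemma equivp_sq_cong: "equivp (sq_cong :: ('n::finite) rpoly \<Rightarrow> _)"
proof (rule equivpI)
  show "reflp (sq_cong :: 'n rpoly \<Rightarrow> _)"
    by (rule reflpI) (simp add: sq_cong_def sq_ideal_zero)
  show "symp (sq_cong :: 'n rpoly \<Rightarrow> _)"
  proof (rule sympI)
    fix p q :: "'n rpoly"
    assume "sq_cong p q"
    then show "sq_cong q p"
      using sq_ideal_uminus[of "p - q"] by (simp add: sq_cong_def)
  qed
  show "transp (sq_cong :: 'n rpoly \<Rightarrow> _)"
  proof (rule transpI)
    fix p q r :: "'n rpoly"
    assume "sq_cong p q" "sq_cong q r"
    then show "sq_cong p r"
      using sq_ideal_add[of "p - q" "q - r"] by (simp add: sq_cong_def)
  qed
qed

quotient_type 'n sqalg = "('n::finite) rpoly" / sq_cong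
  by (rule equivp_sq_cong)

definition sq_expo :: "('n::finite) set \<Rightarrow> ('n \<Rightarrow>\<^sub>0 nat)" where
  "sq_expo S = (\<Sum>i\<in>S. Poly_Mapping.single i 1)"

lemma lookup_sq_expo: "Poly_Mapping.lookup (sq_expo S) i = (if i \<in> S then 1 else 0)"
  by (simp add: sq_expo_def Poly_Mapping.lookup_sum Poly_Mapping.lookup_single when_def sum.delta)

lemma pvar_square: "pvar i ^ 2 = Poly_Mapping.single (Poly_Mapping.single i 2) 1"
  by (simp add: pvar_def power2_eq_square mult_single numeral_2_eq_2 flip: single_add)

lemma sq_ideal_lookup:
  assumes "p \<in> sq_ideal" shows "Poly_Mapping.lookup p (sq_expo S) = 0"
proof -
  obtain a where p: "p = (\<Sum>i\<in>UNIV. a i * pvar i ^ 2)"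
    using assms unfolding sq_ideal_def by blast
  have ne: "sq_expo S \<noteq> l + Poly_Mapping.single i 2" for l i
  proof
    assume "sq_expo S = l + Poly_Mapping.single i 2"
    then have "Poly_Mapping.lookup (sq_expo S) i = Poly_Mapping.lookup l i + 2"
      by (simp add: lookup_add)
    then show False by (simp add: lookup_sq_expo split: if_splits)
  qed
  have "Poly_Mapping.lookup (a i * pvar i ^ 2) (sq_expo S) = 0" for i
  proof -
    have "(\<Sum>q. Poly_Mapping.lookup (pvar i ^ 2) q when sq_expo S = l + q) = 0" for l
    proof -
      have "(Poly_Mapping.lookup (pvar i ^ 2) q when sq_expo S = l + q) = 0" for q
        using ne[of l i] by (auto simp: pvar_square lookup_single when_def)
      then show ?thesis by simp
    qed
    then show ?thesis by (simp add: lookup_mult)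
  qed
  then show ?thesis by (simp add: p lookup_sum)
qed

instantiation sqalg :: (finite) comm_ring_1
begin

lift_definition zero_sqalg :: "'a sqalg" is 0 .
lift_definition one_sqalg :: "'a sqalg" is 1 .

lift_definition plus_sqalg :: "'a sqalg \<Rightarrow> 'a sqalg \<Rightarrow> 'a sqalg" is "(+)"
  unfolding sq_cong_def by (simp only: add_diff_add sq_ideal_add)

lift_definition uminus_sqalg :: "'a sqalg \<Rightarrow> 'a sqalg" is uminus
  unfolding sq_cong_def by (simp only: minus_diff_minus sq_ideal_uminus)

lift_definition minus_sqalg :: "'a sqalg \<Rightarrow> 'a sqalg \<Rightarrow> 'a sqalg" is "(-)"
proof -
  fix p p' q q' :: "'a rpoly"
  assume "sq_cong p p'" "sq_cong q q'"
  then have "(p - p') + - (q - q') \<in> sq_ideal"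
    unfolding sq_cong_def by (intro sq_ideal_add sq_ideal_uminus)
  then show "sq_cong (p - q) (p' - q')"
    by (simp add: sq_cong_def algebra_simps)
qed

lift_definition times_sqalg :: "'a sqalg \<Rightarrow> 'a sqalg \<Rightarrow> 'a sqalg" is "(*)"
proof -
  fix p p' q q' :: "'a rpoly"
  assume "sq_cong p p'" "sq_cong q q'"
  then have "q * (p - p') + p' * (q - q') \<in> sq_ideal"
    unfolding sq_cong_def by (intro sq_ideal_add sq_ideal_mult)
  then show "sq_cong (p * q) (p' * q')"
    by (simp add: sq_cong_def algebra_simps)
qed

instance
proof
  fix a b c :: "'a sqalg"
  have refl: "sq_cong p p" for p :: "'a rpoly"
    by (rule equivp_reflp[OF equivp_sq_cong])
  show "a + b + c = a + (b + c)" by transfer (simp add: refl add.assoc)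
  show "a + b = b + a" by transfer (simp add: refl add.commute)
  show "0 + a = a" by transfer (simp add: refl)
  show "- a + a = 0" by transfer (simp add: refl)
  show "a - b = a + - b" by transfer (simp add: refl)
  show "a * b * c = a * (b * c)" by transfer (simp add: refl mult.assoc)
  show "a * b = b * a" by transfer (simp add: refl mult.commute)
  show "1 * a = a" by transfer (simp add: refl)
  show "(a + b) * c = a * c + b * c" by transfer (simp add: refl distrib_right)
  have "(1 :: 'a rpoly) \<notin> sq_ideal"
    using sq_ideal_lookup[of 1 "{}"] by (auto simp: sq_expo_def)
  then show "(0 :: 'a sqalg) \<noteq> 1"
    using sq_ideal_uminus[of "- 1 :: 'a rpoly"] by transfer (auto simp: sq_cong_def)
qed

end

lemma lookup_scale: "Poly_Mapping.lookup (Poly_Mapping.single 0 c * p) k = c * Poly_Mapping.lookup p k"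
  for p :: "'n rpoly"
  by (simp add: map.rep_eq when_def flip: mult_map_scale_conv_mult)

instantiation sqalg :: (finite) real_algebra_1
begin

lift_definition scaleR_sqalg :: "real \<Rightarrow> 'a sqalg \<Rightarrow> 'a sqalg"
  is "\<lambda>c p. Poly_Mapping.single 0 c * p"
proof -
  fix c :: real and p q :: "'a rpoly"
  assume "sq_cong p q"
  then show "sq_cong (Poly_Mapping.single 0 c * p) (Poly_Mapping.single 0 c * q)"
    unfolding sq_cong_def by (simp only: sq_ideal_mult flip: right_diff_distrib)
qed

instance
proof
  fix a b :: real and x y :: "'a sqalg"
  have refl: "sq_cong p p" for p :: "'a rpoly"
    by (rule equivp_reflp[OF equivp_sq_cong])
  show "a *\<^sub>R (x + y) = a *\<^sub>R x + a *\<^sub>R y"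
    by transfer (simp add: refl distrib_left)
  show "(a + b) *\<^sub>R x = a *\<^sub>R x + b *\<^sub>R x"
    by transfer (simp add: refl distrib_right single_add)
  show "a *\<^sub>R b *\<^sub>R x = (a * b) *\<^sub>R x"
    by transfer (simp add: refl mult_single flip: mult.assoc)
  show "1 *\<^sub>R x = x"
    by transfer (simp add: refl)
  show "a *\<^sub>R x * y = a *\<^sub>R (x * y)"
    by transfer (simp add: refl mult.assoc)
  show "x * a *\<^sub>R y = a *\<^sub>R (x * y)"
    by transfer (simp add: refl mult.left_commute)
qed

end

lift_definition tvar :: "'n \<Rightarrow> ('n::finite) sqalg" is pvar .

definition tmon :: "('n::finite) set \<Rightarrow> 'n sqalg" where
  "tmon S = (\<Prod>i\<in>S. tvar i)"

text \<open>
  The coefficient of \<open>t\<^sup>S\<close>: read off from any representing polynomial, since the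
  polynomials in the ideal have no squarefree monomials. The lemmas \<open>sqalg_expand\<close> and
  \<open>sq_coeff_unique\<close> below say that these are the coordinates with respect to the
  basis of the squarefree monomials.
\<close>

lift_definition sq_coeff :: "('n::finite) sqalg \<Rightarrow> 'n set \<Rightarrow> real"
  is "\<lambda>p S. Poly_Mapping.lookup p (sq_expo S)"
proof (rule ext)
  fix p q :: "'n rpoly" and S :: "'n set"
  assume "sq_cong p q"
  then show "Poly_Mapping.lookup p (sq_expo S) = Poly_Mapping.lookup q (sq_expo S)"
    using sq_ideal_lookup[of "p - q" S] by (simp add: sq_cong_def lookup_minus)
qed

lemma sq_coeff_0 [simp]: "sq_coeff 0 S = 0"
  by transfer simp

lemma sq_coeff_add: "sq_coeff (f + g) S = sq_coeff f S + sq_coeff g S"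
  by transfer (simp add: lookup_add)

lemma sq_coeff_scaleR: "sq_coeff (c *\<^sub>R f) S = c * sq_coeff f S"
  by transfer (simp add: lookup_scale)

lemma sq_coeff_sum: "sq_coeff (\<Sum>x\<in>A. f x) S = (\<Sum>x\<in>A. sq_coeff (f x) S)"
  by (induction A rule: infinite_finite_induct) (auto simp: sq_coeff_add)

lemma tmon_abs: "tmon S = abs_sqalg (Poly_Mapping.single (sq_expo S) 1)"
proof -
  have "finite S" by simp
  then show ?thesis
  proof (induction S rule: finite_induct)
    case empty
    then show ?case by (simp add: tmon_def sq_expo_def one_sqalg_def)
  next
    case (insert i S)
    then show ?case
      by (simp add: tmon_def sq_expo_def tvar.abs_eq pvar_def times_sqalg.abs_eq mult_single)
  qed
qed

lemma sq_expo_inject: "sq_expo S = sq_expo T \<longleftrightarrow> S = T"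
proof
  assume "sq_expo S = sq_expo T"
  then have "Poly_Mapping.lookup (sq_expo S) i = Poly_Mapping.lookup (sq_expo T) i" for i by simp
  then have "i \<in> S \<longleftrightarrow> i \<in> T" for i
    by (metis lookup_sq_expo zero_neq_one)
  then show "S = T" by blast
qed simp

lemma sq_coeff_tmon: "sq_coeff (tmon T) S = (if S = T then 1 else 0)"
  by (auto simp: tmon_abs sq_coeff.abs_eq lookup_single when_def sq_expo_inject)

lemma sq_coeff_unique:
  assumes "f = (\<Sum>S\<in>UNIV. c S *\<^sub>R tmon S)"
  shows "c S = sq_coeff f S"
  by (simp add: assms sq_coeff_sum sq_coeff_scaleR sq_coeff_tmon if_distrib sum.delta cong: if_cong)

lemma sqalg_expand: "f = (\<Sum>S\<in>UNIV. sq_coeff f S *\<^sub>R tmon S)"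
proof -
  have add: "(\<Sum>S\<in>UNIV. sq_coeff (f + g) S *\<^sub>R tmon S) =
      (\<Sum>S\<in>UNIV. sq_coeff f S *\<^sub>R tmon S) + (\<Sum>S\<in>UNIV. sq_coeff g S *\<^sub>R tmon S)" for f g :: "'a sqalg"
    by (simp add: sq_coeff_add scaleR_add_left sum.distrib)
  have single: "abs_sqalg (Poly_Mapping.single k c) =
      (\<Sum>S\<in>UNIV. sq_coeff (abs_sqalg (Poly_Mapping.single k c)) S *\<^sub>R tmon S)"
    for k :: "'a \<Rightarrow>\<^sub>0 nat" and c
  proof (cases "\<exists>i. Poly_Mapping.lookup k i \<ge> 2")
    case True
    then obtain i where i: "Poly_Mapping.lookup k i \<ge> 2" by blast
    define l where "l = k - Poly_Mapping.single i 2"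
    have k: "k = l + Poly_Mapping.single i 2"
      by (rule poly_mapping_eqI)
        (use i in \<open>auto simp: l_def lookup_add lookup_minus lookup_single when_def\<close>)
    have "(\<Sum>j\<in>UNIV. (if j = i then Poly_Mapping.single l c else 0) * pvar j ^ 2) =
        (\<Sum>j\<in>UNIV. if j = i then Poly_Mapping.single l c * pvar i ^ 2 else 0)"
      by (rule sum.cong) auto
    also have "\<dots> = Poly_Mapping.single k c"
      by (simp add: k pvar_square mult_single)
    finally have "Poly_Mapping.single k c \<in> sq_ideal"
      unfolding sq_ideal_def by (intro CollectI exI) (rule sym)
    then have "abs_sqalg (Poly_Mapping.single k c) = 0"
      by (simp add: zero_sqalg_def sqalg.abs_eq_iff sq_cong_def)
    then show ?thesis by simp
  next
    case False
    then have le: "Poly_Mapping.lookup k i < 2" for i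
      by (auto simp: not_le)
    define T where "T = {i. Poly_Mapping.lookup k i = 1}"
    have k: "k = sq_expo T"
    proof (rule poly_mapping_eqI)
      fix i
      show "Poly_Mapping.lookup k i = Poly_Mapping.lookup (sq_expo T) i"
        using le[of i] by (simp add: lookup_sq_expo T_def)
    qed
    have eq: "abs_sqalg (Poly_Mapping.single k c) = c *\<^sub>R tmon T"
      by (subst k) (simp add: tmon_abs scaleR_sqalg.abs_eq mult_single)
    have "sq_coeff (c *\<^sub>R tmon T) S *\<^sub>R tmon S = (if S = T then c *\<^sub>R tmon T else 0)" for S
      by (simp add: sq_coeff_scaleR sq_coeff_tmon)
    then show ?thesis
      unfolding eq by simp
  qed
  have "abs_sqalg p = (\<Sum>S\<in>UNIV. sq_coeff (abs_sqalg p) S *\<^sub>R tmon S)" for p :: "'a rpoly"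
  proof (induction p rule: update_induct)
    case const
    then show ?case by (simp flip: zero_sqalg_def)
  next
    case (update p k c)
    have "Poly_Mapping.update k c p = p + Poly_Mapping.single k c"
      by (rule poly_mapping_eqI)
        (use update in \<open>auto simp: lookup_update lookup_add lookup_single when_def in_keys_iff\<close>)
    then have "abs_sqalg (Poly_Mapping.update k c p) = abs_sqalg p + abs_sqalg (Poly_Mapping.single k c)"
      by (simp add: plus_sqalg.abs_eq)
    then show ?case
      by (simp only: add flip: update(3) single[of k c])
  qed
  from this[of "rep_sqalg f"] show ?thesis
    by (simp add: Quotient_abs_rep[OF Quotient_sqalg])
qed

text \<open>Meaningful as a logarithm only for \<open>f\<close> with \<open>sq_coeff f {} = 1\<close>.\<close>

definition sq_log :: "('n::finite) sqalg \<Rightarrow> 'n sqalg" where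
  "sq_log f = (\<Sum>k=1..CARD('n). ((- 1) ^ (k + 1) / real k) *\<^sub>R (f - 1) ^ k)"

text \<open>
  A graph is given by its adjacency relation; unless said otherwise its vertex set is the
  whole type.
\<close>

definition simple_graph :: "('n \<Rightarrow> 'n \<Rightarrow> bool) \<Rightarrow> bool" where
  "simple_graph E \<longleftrightarrow> irreflp E \<and> symp E"

definition graph_degree :: "('n::finite \<Rightarrow> 'n \<Rightarrow> bool) \<Rightarrow> 'n \<Rightarrow> nat" where
  "graph_degree E i = card {j. E i j}"

definition degree_matrix :: "('n::finite \<Rightarrow> 'n \<Rightarrow> bool) \<Rightarrow> real ^ 'n ^ 'n" where
  "degree_matrix E = (\<chi> i j. if i = j then real (graph_degree E i) else 0)"

definition adjacency_matrix :: "('n::finite \<Rightarrow> 'n \<Rightarrow> bool) \<Rightarrow> real ^ 'n ^ 'n" where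
  "adjacency_matrix E = (\<chi> i j. if E i j then 1 else 0)"

definition laplacian :: "('n::finite \<Rightarrow> 'n \<Rightarrow> bool) \<Rightarrow> real ^ 'n ^ 'n" where
  "laplacian E = degree_matrix E - adjacency_matrix E"

definition D_matrix :: "('n::finite) sqalg ^ 'n ^ 'n" where
  "D_matrix = (\<chi> i j. if i = j then tvar i else 0)"

definition graph_poly :: "('n::finite \<Rightarrow> 'n \<Rightarrow> bool) \<Rightarrow> 'n sqalg" where
  "graph_poly E = det (mat 1 + D_matrix ** (\<chi> i j. of_real (laplacian E $ i $ j)))"

definition kappa :: "('n::finite \<Rightarrow> 'n \<Rightarrow> bool) \<Rightarrow> 'n set \<Rightarrow> real" where
  "kappa E S = sq_coeff (sq_log (graph_poly E)) S"

definition induced_subgraph :: "('n \<Rightarrow> 'n \<Rightarrow> bool) \<Rightarrow> 'n set \<Rightarrow> 'n \<Rightarrow> 'n \<Rightarrow> bool" where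
  "induced_subgraph E S i j \<longleftrightarrow> i \<in> S \<and> j \<in> S \<and> E i j"

text \<open>
  Quotienting by rotation but not by reversal counts the two directions of a cycle
  separately; for two adjacent vertices the orderings \<open>[i, j]\<close> and \<open>[j, i]\<close> are
  rotations of each other and give one cycle.
\<close>

definition ham_orderings :: "'n set \<Rightarrow> ('n \<Rightarrow> 'n \<Rightarrow> bool) \<Rightarrow> 'n list set" where
  "ham_orderings V E =
     {xs. distinct xs \<and> set xs = V \<and>
          (\<forall>r<length xs. E (xs ! r) (xs ! (Suc r mod length xs)))}"

definition rotation_rel :: "'n list set \<Rightarrow> ('n list \<times> 'n list) set" where
  "rotation_rel A = {(xs, ys). xs \<in> A \<and> ys \<in> A \<and> (\<exists>m. ys = rotate m xs)}"

definition ham_cycle_count :: "'n set \<Rightarrow> ('n \<Rightarrow> 'n \<Rightarrow> bool) \<Rightarrow> nat" where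
  "ham_cycle_count V E = card (ham_orderings V E // rotation_rel (ham_orderings V E))"

end

theory Submission
  imports Defs
begin

text \<open>
  Write \<open>f = det (I - N)\<close> with \<open>N = - D(t) L\<close>, and let \<open>\<theta>\<^sub>i = t\<^sub>i \<partial>/\<partial>t\<^sub>i\<close>, a derivation
  that multiplies the coefficient of \<open>t\<^sup>S\<close> by 1 if \<open>i \<in> S\<close> and by 0 otherwise. Only row
  \<open>i\<close> of \<open>N\<close> depends on \<open>t\<^sub>i\<close>, so \<open>\<theta>\<^sub>i f\<close> is the determinant of \<open>I - N\<close> with row \<open>i\<close>
  replaced by that of \<open>- N\<close>. Since \<open>N\<close> is nilpotent, the Neumann series writes this new row
  as a combination of the rows of \<open>I - N\<close>, and Cramer's rule gives
  \<open>\<theta>\<^sub>i f = - f \<cdot> (\<Sum>\<^sub>k N\<^sup>k\<^sup>+\<^sup>1)\<^sub>i\<^sub>i\<close>. As also \<open>\<theta>\<^sub>i f = f \<cdot> \<theta>\<^sub>i (log f)\<close> and \<open>f\<close> is a unit, the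
  coefficient of \<open>t\<^sup>S\<close> in \<open>log f\<close>, for any \<open>i \<in> S\<close>, is minus the weighted number of closed
  walks from \<open>i\<close> visiting every vertex of \<open>S\<close> exactly once; off the diagonal \<open>- L\<close> is the
  adjacency matrix.
\<close>

section \<open>Coefficients, products and nilpotency in the squarefree algebra\<close>

lemma sqalg_eqI: "(\<And>S. sq_coeff f S = sq_coeff g S) \<Longrightarrow> f = g"
  by (metis (no_types, lifting) sqalg_expand sum.cong)

lemma sq_coeff_uminus: "sq_coeff (- f) S = - sq_coeff f S"
  using sq_coeff_scaleR[of "- 1" f S] by simp

lemma sq_coeff_diff: "sq_coeff (f - g) S = sq_coeff f S - sq_coeff g S"
  using sq_coeff_add[of f "- g" S] by (simp add: sq_coeff_uminus)

lemma sq_coeff_1: "sq_coeff 1 S = (if S = {} then 1 else 0)"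
  using sq_coeff_tmon[of "{}" S] by (simp add: tmon_def)

lemma tvar_square: "tvar i * tvar i = 0"
proof -
  have "pvar i ^ 2 = (\<Sum>j\<in>UNIV. (if j = i then 1 else 0) * pvar j ^ 2)"
    by (simp add: if_distrib[of "\<lambda>x. x * _"] cong: if_cong)
  then have "pvar i ^ 2 \<in> sq_ideal"
    unfolding sq_ideal_def by (intro CollectI exI)
  then show ?thesis
    by transfer (simp add: sq_cong_def power2_eq_square)
qed

lemma tmon_mult: "tmon S * tmon T = (if S \<inter> T = {} then tmon (S \<union> T) else 0)"
proof (cases "S \<inter> T = {}")
  case True
  then show ?thesis by (simp add: tmon_def prod.union_disjoint)
next
  case False
  then obtain i where i: "i \<in> S" "i \<in> T" by blast
  have "tmon S * tmon T = (tvar i * tvar i) * (tmon (S - {i}) * tmon (T - {i}))"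
    unfolding tmon_def using i by (simp add: prod.remove[of _ i] mult_ac)
  with False show ?thesis by (simp add: tvar_square)
qed

text \<open>Expanding both factors in the squarefree basis, \<open>tmon T * tmon U\<close>
  contributes to \<open>tmon S\<close> only if \<open>S\<close> is the disjoint union of
  \<open>T\<close> and \<open>U\<close>, which forces \<open>U = S - T\<close>.\<close>

lemma sq_coeff_mult: "sq_coeff (f * g) S = (\<Sum>T\<in>Pow S. sq_coeff f T * sq_coeff g (S - T))"
proof -
  have "f * g = (\<Sum>T\<in>UNIV. \<Sum>U\<in>UNIV. (sq_coeff f T * sq_coeff g U) *\<^sub>R (tmon T * tmon U))"
    by (subst (1) sqalg_expand[of f], subst (1) sqalg_expand[of g])
      (simp add: sum_product mult.commute)
  then have "sq_coeff (f * g) S = (\<Sum>T\<in>UNIV. \<Sum>U\<in>UNIV.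
      sq_coeff f T * sq_coeff g U * sq_coeff (tmon T * tmon U) S)"
    by (simp add: sq_coeff_sum sq_coeff_scaleR)
  also have "\<dots> = (\<Sum>T\<in>UNIV. if T \<subseteq> S then sq_coeff f T * sq_coeff g (S - T) else 0)"
  proof (rule sum.cong[OF refl])
    fix T
    have "sq_coeff f T * sq_coeff g U * sq_coeff (tmon T * tmon U) S =
        (if U = S - T then (if T \<subseteq> S then sq_coeff f T * sq_coeff g (S - T) else 0) else 0)" for U
      by (auto simp: tmon_mult sq_coeff_tmon)
    then show "(\<Sum>U\<in>UNIV. sq_coeff f T * sq_coeff g U * sq_coeff (tmon T * tmon U) S) =
        (if T \<subseteq> S then sq_coeff f T * sq_coeff g (S - T) else 0)"
      by simp
  qed
  also have "\<dots> = (\<Sum>T\<in>Pow S. sq_coeff f T * sq_coeff g (S - T))"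
    by (simp add: sum.If_cases Pow_def)
  finally show ?thesis .
qed

lemma sq_coeff_mult_empty: "sq_coeff (f * g) {} = sq_coeff f {} * sq_coeff g {}"
  by (simp add: sq_coeff_mult)

lemma sq_coeff_prod_empty: "sq_coeff (\<Prod>x\<in>A. f x) {} = (\<Prod>x\<in>A. sq_coeff (f x) {})"
  by (induction A rule: infinite_finite_induct) (auto simp: sq_coeff_mult_empty sq_coeff_1)

lemma sq_coeff_of_real_mult: "sq_coeff (of_real c * f) S = c * sq_coeff f S"
  by (simp add: of_real_def sq_coeff_scaleR)

lemma sq_coeff_of_real: "sq_coeff (of_real c) S = (if S = {} then c else 0)"
  by (simp add: of_real_def sq_coeff_scaleR sq_coeff_1)

lemma sq_coeff_tvar_mult:
  "sq_coeff (tvar i * f) S = (if i \<in> S then sq_coeff f (S - {i}) else 0)"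
proof -
  have "tvar i = tmon {i}" by (simp add: tmon_def)
  then have "sq_coeff (tvar i * f) S = (\<Sum>T\<in>Pow S. if T = {i} then sq_coeff f (S - {i}) else 0)"
    by (auto simp: sq_coeff_mult sq_coeff_tmon mult_delta_left intro!: sum.cong)
  then show ?thesis by simp
qed

text \<open>Each of the \<open>k\<close> factors must supply at least one variable, and no variable
  can be supplied twice.\<close>

lemma sq_coeff_power_eq_0:
  assumes "sq_coeff u {} = 0" "card S < k"
  shows "sq_coeff (u ^ k) S = 0"
  using assms(2)
proof (induction k arbitrary: S)
  case (Suc k)
  have "sq_coeff u T * sq_coeff (u ^ k) (S - T) = 0" if "T \<subseteq> S" for T
  proof (cases "T = {}")
    case False
    then have "card (S - T) < card S"
      using that by (intro psubset_card_mono) auto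
    then show ?thesis using Suc by simp
  qed (simp add: assms(1))
  then show ?case by (auto simp: sq_coeff_mult intro!: sum.neutral)
qed simp

lemma sq_nilpotent:
  fixes u :: "('n::finite) sqalg"
  assumes "sq_coeff u {} = 0"
  shows "u ^ Suc CARD('n) = 0"
proof (rule sqalg_eqI)
  fix S :: "'n set"
  have "card S \<le> CARD('n)" by (simp add: card_mono)
  then show "sq_coeff (u ^ Suc CARD('n)) S = sq_coeff 0 S"
    by (simp only: sq_coeff_power_eq_0[OF assms] less_Suc_eq_le sq_coeff_0)
qed

section \<open>Euler derivations and the logarithm\<close>

text \<open>The operator \<open>t\<^sub>i \<partial>/\<partial>t\<^sub>i\<close>.\<close>

definition euler_deriv :: "'n \<Rightarrow> ('n::finite) sqalg \<Rightarrow> 'n sqalg" where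
  "euler_deriv i f = (\<Sum>S | i \<in> S. sq_coeff f S *\<^sub>R tmon S)"

lemma sq_coeff_euler_deriv: "sq_coeff (euler_deriv i f) S = (if i \<in> S then sq_coeff f S else 0)"
  by (simp add: euler_deriv_def sq_coeff_sum sq_coeff_scaleR sq_coeff_tmon
      if_distrib[of "\<lambda>x. _ * x"] cong: if_cong)

lemma euler_deriv_1: "euler_deriv i 1 = 0"
  by (rule sqalg_eqI) (simp add: sq_coeff_euler_deriv sq_coeff_1)

lemma euler_deriv_0: "euler_deriv i 0 = 0"
  by (rule sqalg_eqI) (simp add: sq_coeff_euler_deriv)

lemma euler_deriv_diff: "euler_deriv i (f - g) = euler_deriv i f - euler_deriv i g"
  by (rule sqalg_eqI) (simp add: sq_coeff_euler_deriv sq_coeff_diff)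

lemma euler_deriv_scaleR: "euler_deriv i (c *\<^sub>R f) = c *\<^sub>R euler_deriv i f"
  by (rule sqalg_eqI) (simp add: sq_coeff_euler_deriv sq_coeff_scaleR)

lemma euler_deriv_sum: "euler_deriv i (\<Sum>x\<in>A. f x) = (\<Sum>x\<in>A. euler_deriv i (f x))"
  by (rule sqalg_eqI) (simp add: sq_coeff_euler_deriv sq_coeff_sum)

text \<open>When \<open>S\<close> splits into \<open>T\<close> and \<open>S - T\<close>, an index
  \<open>i\<close> of \<open>S\<close> lies in exactly one of the two, so exactly one of the two
  terms on the right survives.\<close>

lemma euler_deriv_mult: "euler_deriv i (f * g) = euler_deriv i f * g + f * euler_deriv i g"
proof (rule sqalg_eqI)
  fix S
  show "sq_coeff (euler_deriv i (f * g)) S =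
      sq_coeff (euler_deriv i f * g + f * euler_deriv i g) S"
    unfolding sq_coeff_euler_deriv sq_coeff_add sq_coeff_mult sum.distrib[symmetric]
    by (cases "i \<in> S") (auto intro!: sum.cong sum.neutral)
qed

lemma euler_deriv_power:
  "euler_deriv i (f ^ Suc k) = real (Suc k) *\<^sub>R (f ^ k * euler_deriv i f)"
proof (induction k)
  case (Suc k)
  have "euler_deriv i (f ^ Suc (Suc k)) = euler_deriv i f * f ^ Suc k + f * euler_deriv i (f ^ Suc k)"
    by (simp only: power_Suc[of f "Suc k"] euler_deriv_mult)
  also have "\<dots> = real (Suc (Suc k)) *\<^sub>R (f ^ Suc k * euler_deriv i f)"
    by (subst Suc) (simp add: algebra_simps scaleR_conv_of_real)
  finally show ?case .
qed simp

lemma euler_deriv_prod_eq_0: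
  "(\<And>x. x \<in> A \<Longrightarrow> euler_deriv i (f x) = 0) \<Longrightarrow> euler_deriv i (\<Prod>x\<in>A. f x) = 0"
  by (induction A rule: infinite_finite_induct) (auto simp: euler_deriv_1 euler_deriv_mult)

text \<open>With \<open>u = f - 1\<close>, differentiating the truncated series turns it into a
  geometric sum in \<open>- u\<close> times \<open>euler_deriv i f\<close>. Multiplying by
  \<open>f = 1 - (- u)\<close> collapses the sum up to a remainder, which vanishes.\<close>

lemma euler_deriv_log:
  fixes f :: "('n::finite) sqalg"
  assumes "sq_coeff f {} = 1"
  shows "f * euler_deriv i (sq_log f) = euler_deriv i f"
proof -
  define u where "u = f - 1"
  have u0: "sq_coeff u {} = 0" using assms by (simp add: u_def sq_coeff_diff sq_coeff_1)
  have du: "euler_deriv i u = euler_deriv i f" by (simp add: u_def euler_deriv_diff euler_deriv_1)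
  let ?N = "CARD('n)"
  \<comment> \<open>The remainder contains only the \<open>?N\<close>-th power of \<open>u\<close>;
    differentiating the vanishing next power shows that it still dies against
    \<open>euler_deriv i u\<close>.\<close>
  have "u ^ Suc ?N = 0" by (rule sq_nilpotent[OF u0])
  then have "real (Suc ?N) *\<^sub>R (u ^ ?N * euler_deriv i u) = 0"
    by (simp only: euler_deriv_power[symmetric] euler_deriv_0)
  then have nil: "u ^ ?N * euler_deriv i f = 0" by (simp add: du)
  have "sq_log f = (\<Sum>k<?N. ((- 1) ^ k / real (Suc k)) *\<^sub>R u ^ Suc k)"
    unfolding sq_log_def u_def One_nat_def
    by (simp add: sum.atLeast1_atMost_eq)
  then have "euler_deriv i (sq_log f) = (\<Sum>k<?N. (- u) ^ k) * euler_deriv i f"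
    by (simp add: euler_deriv_sum euler_deriv_scaleR euler_deriv_power du sum_distrib_right
        del: power_Suc of_nat_Suc)
      (simp add: power_minus[of u] scaleR_conv_of_real mult.assoc)
  moreover have "f * (\<Sum>k<?N. (- u) ^ k) = 1 - (- u) ^ ?N"
    by (simp add: one_diff_power_eq u_def)
  ultimately have "f * euler_deriv i (sq_log f) = euler_deriv i f - (- u) ^ ?N * euler_deriv i f"
    by (simp add: mult.assoc[symmetric] left_diff_distrib)
  also have "(- u) ^ ?N * euler_deriv i f = (- 1) ^ ?N * (u ^ ?N * euler_deriv i f)"
    by (simp add: power_minus[of u])
  finally show ?thesis by (simp add: nil)
qed

text \<open>\<open>f\<close> is a unit: for \<open>u = 1 - f\<close> the difference
  \<open>d = g - h\<close> satisfies \<open>d = u * d\<close>, hence \<open>d = u ^ k * d\<close>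
  for all \<open>k\<close>, and \<open>u\<close> is nilpotent.\<close>

lemma sq_mult_left_cancel:
  fixes f :: "('n::finite) sqalg"
  assumes "sq_coeff f {} = 1" "f * g = f * h"
  shows "g = h"
proof -
  define u where "u = 1 - f"
  define d where "d = g - h"
  have u0: "sq_coeff u {} = 0" using assms by (simp add: u_def sq_coeff_diff sq_coeff_1)
  have "d = u * d" using assms(2) by (simp add: u_def d_def algebra_simps)
  then have "d = u ^ k * d" for k
  proof (induction k)
    case (Suc k)
    then show ?case using \<open>d = u * d\<close> by (metis mult.assoc power_Suc)
  qed simp
  moreover have "u ^ Suc CARD('n) = 0" by (rule sq_nilpotent[OF u0])
  ultimately have "d = 0" by (metis mult_zero_left)
  then show ?thesis by (simp add: d_def)
qed

section \<open>Row operations and derivatives of determinants\<close>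

text \<open>Cramer's rule in row form: by linearity in row \<open>i\<close>, each term with
  \<open>k \<noteq> i\<close> has two equal rows and vanishes.\<close>

lemma det_row_combination:
  fixes A :: "'a::comm_ring_1 ^ 'n ^ 'n"
  shows "det (\<chi> r. if r = i then (\<Sum>k\<in>UNIV. x k *s A $ k) else A $ r) = x i * det A"
proof -
  have "det (\<chi> r. if r = i then A $ k else A $ r) = (if k = i then det A else 0)" for k
  proof (cases "k = i")
    case True
    then have "(\<chi> r. if r = i then A $ k else A $ r) = A"
      by (simp add: vec_eq_iff)
    with True show ?thesis by simp
  next
    case False
    then show ?thesis
      by (simp add: det_identical_rows[of i k] row_def)
  qed
  then show ?thesis
    by (simp add: det_linear_row_sum det_row_mul if_distrib[of "\<lambda>y. _ * y"] cong: if_cong)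
qed

text \<open>Every product in the Leibniz formula has exactly one factor from row \<open>i\<close>,
  and the derivation kills all its other factors.\<close>

lemma euler_deriv_det:
  fixes A :: "('n::finite) sqalg ^ 'n ^ 'n"
  assumes "\<And>j k. j \<noteq> i \<Longrightarrow> euler_deriv i (A $ j $ k) = 0"
  shows "euler_deriv i (det A) =
    det (\<chi> j. if j = i then (\<chi> k. euler_deriv i (A $ i $ k)) else A $ j)"
proof -
  have prod: "euler_deriv i (\<Prod>j\<in>UNIV. A $ j $ p j) =
      (\<Prod>j\<in>UNIV. (\<chi> j. if j = i then (\<chi> k. euler_deriv i (A $ i $ k)) else A $ j) $ j $ p j)"
    for p :: "'n \<Rightarrow> 'n"
  proof -
    have "euler_deriv i (\<Prod>j\<in>UNIV - {i}. A $ j $ p j) = 0"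
      by (rule euler_deriv_prod_eq_0) (simp add: assms)
    then show ?thesis
      by (simp add: prod.remove[of UNIV i] euler_deriv_mult)
  qed
  have sgn: "euler_deriv i (of_int (sign p) * g) = of_int (sign p) * euler_deriv i g"
    for p :: "'n \<Rightarrow> 'n" and g
    using euler_deriv_scaleR[of i "- 1" g] by (simp add: sign_def)
  show ?thesis
    unfolding det_def euler_deriv_sum sgn prod ..
qed

section \<open>Matrix powers as sums over walks\<close>

primrec mat_power :: "'a::comm_ring_1 ^ 'n ^ 'n \<Rightarrow> nat \<Rightarrow> 'a ^ 'n ^ 'n" where
  "mat_power A 0 = mat 1"
| "mat_power A (Suc k) = A ** mat_power A k"

text \<open>The recursion multiplies on the left, whereas the Neumann series is applied to rows and
  needs multiplication on the right.\<close>

lemma mat_power_commutes: "mat_power A k ** A = A ** mat_power A k"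
  by (induction k) (simp_all flip: matrix_mul_assoc)

definition weighted_matrix :: "real ^ 'n ^ 'n \<Rightarrow> ('n::finite) sqalg ^ 'n ^ 'n" where
  "weighted_matrix W = (\<chi> i j. tvar i * of_real (W $ i $ j))"

text \<open>The walk runs through \<open>xs\<close> and ends with a step to \<open>j\<close>. Taking
  \<open>j = hd xs\<close> closes it.\<close>

definition walk_weight :: "real ^ 'n ^ 'n \<Rightarrow> 'n list \<Rightarrow> 'n \<Rightarrow> real" where
  "walk_weight W xs j = (\<Prod>r<length xs. W $ (xs ! r) $ ((xs @ [j]) ! Suc r))"

lemma walk_weight_Cons:
  "walk_weight W (x # xs) j = W $ x $ hd (xs @ [j]) * walk_weight W xs j"
  by (simp add: walk_weight_def prod.lessThan_Suc_shift hd_conv_nth del: prod.lessThan_Suc)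

definition orderings_from :: "'n set \<Rightarrow> 'n \<Rightarrow> 'n list set" where
  "orderings_from S i = {xs. distinct xs \<and> set xs = S \<and> xs \<noteq> [] \<and> hd xs = i}"

lemma finite_orderings_from: "finite (orderings_from (S :: 'n::finite set) i)"
  by (rule finite_subset[OF _ finite_subset_distinct[of S]]) (auto simp: orderings_from_def)

lemma orderings_from_notin: "i \<notin> S \<Longrightarrow> orderings_from S i = {}"
  by (auto simp: orderings_from_def)

lemma orderings_from_singleton: "orderings_from {i} i = {[i]}"
proof -
  have "xs = [i]" if "distinct xs" "set xs = {i}" for xs
  proof -
    have "length xs = Suc 0" using distinct_card[OF that(1)] that(2) by simp
    then obtain y where "xs = [y]" unfolding length_Suc_conv by blast
    with that(2) show ?thesis by simp
  qed
  then show ?thesis by (auto simp: orderings_from_def)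
qed

text \<open>Splits the orderings by their second vertex \<open>l\<close>, which exists since
  \<open>S - {i}\<close> is nonempty.\<close>

lemma sum_orderings_from_Cons:
  fixes S :: "'n::finite set"
  assumes "i \<in> S" "S - {i} \<noteq> {}"
  shows "(\<Sum>ys\<in>orderings_from S i. F ys) =
    (\<Sum>l\<in>UNIV. \<Sum>xs\<in>orderings_from (S - {i}) l. F (i # xs))"
proof -
  have "(\<Sum>l\<in>UNIV. \<Sum>xs\<in>orderings_from (S - {i}) l. F (i # xs)) =
      (\<Sum>(l, xs)\<in>Sigma UNIV (orderings_from (S - {i})). F (i # xs))"
    by (simp add: sum.Sigma finite_orderings_from)
  also have "\<dots> = (\<Sum>ys\<in>orderings_from S i. F ys)"
  proof (rule sum.reindex_bij_witness[of _ "\<lambda>ys. (hd (tl ys), tl ys)" "\<lambda>(l, xs). i # xs"])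
    fix ys assume "ys \<in> orderings_from S i"
    then show "(hd (tl ys), tl ys) \<in> Sigma UNIV (orderings_from (S - {i}))"
      using assms by (cases ys) (auto simp: orderings_from_def)
  qed (use assms in \<open>auto simp: orderings_from_def\<close>)
  finally show ?thesis ..
qed

text \<open>A walk collects \<open>tvar x\<close> each time it leaves a vertex \<open>x\<close>, so
  squares vanishing kills every walk that leaves a vertex twice. The end point \<open>j\<close>
  contributes no variable and may therefore repeat an earlier vertex. The induction removes the
  first vertex.\<close>

lemma sq_coeff_weighted_mat_power:
  "sq_coeff (mat_power (weighted_matrix W) (Suc k) $ i $ j) S =
    (if card S = Suc k then \<Sum>xs\<in>orderings_from S i. walk_weight W xs j else 0)"
proof (induction k arbitrary: i S)
  case 0
  have "sq_coeff (tvar i * of_real (W $ i $ j)) S = (if S = {i} then W $ i $ j else 0)"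
    by (auto simp: sq_coeff_tvar_mult sq_coeff_of_real)
  moreover have "(\<Sum>xs\<in>orderings_from S i. walk_weight W xs j) = (if S = {i} then W $ i $ j else 0)"
    if card1: "card S = 1"
  proof -
    from card1 obtain s where s: "S = {s}" by (rule card_1_singletonE)
    show ?thesis
    proof (cases "s = i")
      case True
      then show ?thesis by (simp add: s orderings_from_singleton walk_weight_def)
    next
      case False
      then show ?thesis by (simp add: s orderings_from_notin)
    qed
  qed
  ultimately show ?case
    by (auto simp: weighted_matrix_def)
next
  case (Suc k)
  let ?N = "weighted_matrix W"
  have "mat_power ?N (Suc (Suc k)) $ i $ j =
      (\<Sum>l\<in>UNIV. tvar i * (of_real (W $ i $ l) * mat_power ?N (Suc k) $ l $ j))"
    by (subst mat_power.simps(2)) (simp add: matrix_matrix_mult_def weighted_matrix_def mult.assoc)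
  then have eq: "sq_coeff (mat_power ?N (Suc (Suc k)) $ i $ j) S =
      (if i \<in> S then \<Sum>l\<in>UNIV. W $ i $ l * (if card (S - {i}) = Suc k
        then \<Sum>xs\<in>orderings_from (S - {i}) l. walk_weight W xs j else 0) else 0)"
    by (simp add: sq_coeff_sum sq_coeff_tvar_mult sq_coeff_of_real_mult Suc del: mat_power.simps)
  show ?case
  proof (cases "i \<in> S \<and> card S = Suc (Suc k)")
    case True
    then have i: "i \<in> S" and c: "card (S - {i}) = Suc k"
      by (auto simp: card_Diff_singleton)
    from c have ne: "S - {i} \<noteq> {}" by (metis card.empty nat.distinct(1))
    have "walk_weight W (i # xs) j = W $ i $ l * walk_weight W xs j"
      if "xs \<in> orderings_from (S - {i}) l" for xs l
      using that by (auto simp: walk_weight_Cons orderings_from_def)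
    then show ?thesis
      using True i c ne unfolding eq
      by (simp add: sum_orderings_from_Cons sum_distrib_left)
  next
    case False
    show ?thesis
    proof (cases "i \<in> S")
      case True
      then have "card (S - {i}) \<noteq> Suc k" "card S \<noteq> Suc (Suc k)"
        using False by (auto simp: card_Diff_singleton)
      then show ?thesis by (simp only: eq if_False mult_zero_right sum.neutral_const if_cancel)
    qed (simp add: eq orderings_from_notin del: mat_power.simps)
  qed
qed

section \<open>The logarithm of the determinant\<close>

text \<open>Taking constant terms is multiplicative and additive, and it sends the matrix to the
  identity.\<close>

lemma det_weighted_sq_coeff_empty:
  fixes W :: "real ^ 'n::finite ^ 'n"
  shows "sq_coeff (det (mat 1 - weighted_matrix W)) {} = 1"
proof -
  have entry: "sq_coeff ((mat 1 - weighted_matrix W) $ i $ j) {} = (mat 1 :: real ^ 'n ^ 'n) $ i $ j"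
    for i j :: 'n
    by (simp add: sq_coeff_diff weighted_matrix_def sq_coeff_tvar_mult mat_def sq_coeff_1)
  have sgn: "sq_coeff (of_int (sign p) * g) {} = of_int (sign p) * sq_coeff g {}"
    for p :: "'n \<Rightarrow> 'n" and g :: "'n sqalg"
    by (simp add: sign_def sq_coeff_uminus)
  have "sq_coeff (det (mat 1 - weighted_matrix W)) {} = det (mat 1 :: real ^ 'n ^ 'n)"
    unfolding det_def sq_coeff_sum sgn sq_coeff_prod_empty entry ..
  then show ?thesis by simp
qed

lemma euler_deriv_det_weighted:
  fixes W :: "real ^ 'n::finite ^ 'n"
  defines "N \<equiv> weighted_matrix W"
  shows "euler_deriv i (det (mat 1 - N)) =
    det (mat 1 - N) * - (\<Sum>k<CARD('n). mat_power N (Suc k) $ i $ i)"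
proof -
  \<comment> \<open>Row \<open>i\<close> of \<open>- (N + ... + N^n)\<close> with
    \<open>n = CARD('n)\<close>. Multiplied by \<open>mat 1 - N\<close> it telescopes to row
    \<open>i\<close> of \<open>- N\<close>, because \<open>N^(n+1) = 0\<close>.\<close>
  define x where "x l = - (\<Sum>k<CARD('n). mat_power N (Suc k) $ i $ l)" for l
  have nil: "mat_power N (Suc CARD('n)) $ i $ j = 0" for j
  proof (rule sqalg_eqI)
    fix S :: "'n set"
    \<comment> \<open>A nonzero coefficient would require a set of \<open>n + 1\<close>
      indices.\<close>
    have "card S \<noteq> Suc CARD('n)" using card_mono[of UNIV S] by simp
    then show "sq_coeff (mat_power N (Suc CARD('n)) $ i $ j) S = sq_coeff 0 S"
      by (simp add: N_def sq_coeff_weighted_mat_power del: mat_power.simps)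
  qed
  have step: "(\<Sum>l\<in>UNIV. mat_power N k $ i $ l * N $ l $ j) = mat_power N (Suc k) $ i $ j" for k j
    using mat_power_commutes[of N k] by (simp add: matrix_matrix_mult_def vec_eq_iff)
  have comb: "(\<Sum>l\<in>UNIV. x l *s (mat 1 - N) $ l) $ j = - N $ i $ j" for j
  proof -
    have "(\<Sum>l\<in>UNIV. x l *s (mat 1 - N) $ l) $ j = x j - (\<Sum>l\<in>UNIV. x l * N $ l $ j)"
      by (simp add: right_diff_distrib sum_subtractf mat_def if_distrib[of "\<lambda>y. _ * y"] cong: if_cong)
    also have "(\<Sum>l\<in>UNIV. x l * N $ l $ j) =
        - (\<Sum>k<CARD('n). \<Sum>l\<in>UNIV. mat_power N (Suc k) $ i $ l * N $ l $ j)"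
      unfolding x_def by (subst sum.swap) (simp add: sum_distrib_right sum_negf)
    also have "\<dots> = - (\<Sum>k<CARD('n). mat_power N (Suc (Suc k)) $ i $ j)"
      by (simp only: step)
    also have "x j - \<dots> = - (\<Sum>k<CARD('n). mat_power N (Suc k) $ i $ j - mat_power N (Suc (Suc k)) $ i $ j)"
      by (simp add: x_def sum_subtractf del: mat_power.simps)
    also have "\<dots> = - (mat_power N (Suc 0) $ i $ j - mat_power N (Suc CARD('n)) $ i $ j)"
      using sum_lessThan_telescope'[of "\<lambda>k. mat_power N (Suc k) $ i $ j" "CARD('n)"]
      by (simp only:)
    finally show ?thesis by (simp add: nil del: mat_power.simps(2)) simp
  qed
  have d: "euler_deriv i ((mat 1 - N) $ j $ k) = (if j = i then - N $ j $ k else 0)" for j k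
    by (rule sqalg_eqI)
      (auto simp: sq_coeff_euler_deriv N_def weighted_matrix_def mat_def sq_coeff_diff
        sq_coeff_uminus sq_coeff_tvar_mult sq_coeff_1 sq_coeff_of_real)
  have "euler_deriv i (det (mat 1 - N)) =
      det (\<chi> j. if j = i then (\<chi> k. euler_deriv i ((mat 1 - N) $ i $ k)) else (mat 1 - N) $ j)"
    by (rule euler_deriv_det) (simp add: d del: vector_minus_component)
  also have "(\<chi> k. euler_deriv i ((mat 1 - N) $ i $ k)) = (\<Sum>l\<in>UNIV. x l *s (mat 1 - N) $ l)"
    unfolding d vec_eq_iff comb by simp
  also have "det (\<chi> j. if j = i then \<dots> else (mat 1 - N) $ j) = x i * det (mat 1 - N)"
    by (rule det_row_combination)
  finally show ?thesis by (simp add: x_def mult.commute del: mat_power.simps)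
qed

lemma sq_coeff_log_det_weighted:
  assumes "i \<in> S"
  shows "sq_coeff (sq_log (det (mat 1 - weighted_matrix W))) S =
    - (\<Sum>xs\<in>orderings_from S i. walk_weight W xs i)"
proof -
  let ?f = "det (mat 1 - weighted_matrix W)"
  have card0: "card S \<noteq> 0" using assms by auto
  have "?f * euler_deriv i (sq_log ?f) =
      ?f * - (\<Sum>k<CARD('a). mat_power (weighted_matrix W) (Suc k) $ i $ i)"
    by (rule trans[OF euler_deriv_log[OF det_weighted_sq_coeff_empty] euler_deriv_det_weighted])
  then have "euler_deriv i (sq_log ?f) =
      - (\<Sum>k<CARD('a). mat_power (weighted_matrix W) (Suc k) $ i $ i)"
    by (rule sq_mult_left_cancel[OF det_weighted_sq_coeff_empty])
  then have "sq_coeff (sq_log ?f) S =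
      sq_coeff (- (\<Sum>k<CARD('a). mat_power (weighted_matrix W) (Suc k) $ i $ i)) S"
    using assms by (metis sq_coeff_euler_deriv)
  also have "\<dots> = - (\<Sum>k<CARD('a). if card S = Suc k
      then \<Sum>xs\<in>orderings_from S i. walk_weight W xs i else 0)"
    by (simp add: sq_coeff_uminus sq_coeff_sum sq_coeff_weighted_mat_power del: mat_power.simps)
  \<comment> \<open>Only the power with exponent \<open>card S\<close> contributes; since
    \<open>S\<close> is nonempty, its shifted index \<open>card S - 1\<close> is in the range of
    summation.\<close>
  also have "\<dots> = - (\<Sum>k<CARD('a). if k = card S - 1
      then \<Sum>xs\<in>orderings_from S i. walk_weight W xs i else 0)"
  proof -
    have "card S = Suc k \<longleftrightarrow> k = card S - 1" for k using card0 by linarith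
    then show ?thesis by presburger
  qed
  also have "\<dots> = - (\<Sum>xs\<in>orderings_from S i. walk_weight W xs i)"
  proof -
    have "card S \<le> CARD('a)" by (simp add: card_mono)
    then have "card S - 1 < CARD('a)" using card0 by linarith
    then show ?thesis by simp
  qed
  finally show ?thesis .
qed

lemma sq_coeff_log_empty: "sq_coeff f {} = 1 \<Longrightarrow> sq_coeff (sq_log f) {} = 0"
  unfolding sq_log_def sq_coeff_sum sq_coeff_scaleR
  by (intro sum.neutral) (auto simp: sq_coeff_power_eq_0 sq_coeff_diff sq_coeff_1)

section \<open>Hamiltonian orderings modulo rotation\<close>

lemma rotate_ham_orderings:
  assumes "xs \<in> ham_orderings V E"
  shows "rotate m xs \<in> ham_orderings V E"
proof -
  have "E (rotate m xs ! r) (rotate m xs ! (Suc r mod length xs))" if r: "r < length xs" for r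
  proof -
    let ?n = "length xs"
    have n: "0 < ?n" using r by linarith
    have "E (xs ! ((m + r) mod ?n)) (xs ! (Suc ((m + r) mod ?n) mod ?n))"
      using assms n by (simp add: ham_orderings_def)
    moreover have "Suc ((m + r) mod ?n) mod ?n = (m + Suc r mod ?n) mod ?n"
      by (simp add: mod_simps)
    ultimately show ?thesis using r n by (simp add: nth_rotate)
  qed
  then show ?thesis using assms by (simp add: ham_orderings_def)
qed

lemma equiv_rotation_rel: "equiv A (rotation_rel A)"
proof (rule equivI)
  show "rotation_rel A \<subseteq> A \<times> A" by (auto simp: rotation_rel_def)
  show "refl_on A (rotation_rel A)"
    by (auto simp: refl_on_def rotation_rel_def intro: exI[of _ 0])
  show "sym (rotation_rel A)"
  proof (rule symI)
    fix xs ys assume "(xs, ys) \<in> rotation_rel A"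
    then obtain m where m: "xs \<in> A" "ys \<in> A" "ys = rotate m xs"
      by (auto simp: rotation_rel_def)
    \<comment> \<open>Rotating by the complementary amount completes a full turn.\<close>
    have "xs = rotate (length xs - m mod length xs) ys"
    proof (cases "xs = []")
      case False
      then have "rotate (length xs - m mod length xs) (rotate (m mod length xs) xs) = xs"
        by (simp add: rotate_rotate)
      then show ?thesis using m(3) by (simp flip: rotate_conv_mod)
    qed (simp add: m(3))
    then show "(ys, xs) \<in> rotation_rel A" using m by (auto simp: rotation_rel_def)
  qed
  show "trans (rotation_rel A)"
    by (rule transI) (auto simp: rotation_rel_def rotate_rotate)
qed

text \<open>Every rotation class contains exactly one ordering starting at a given vertex.\<close>

lemma ham_cycle_count_eq:
  assumes "i \<in> V"
  shows "ham_cycle_count V E = card {xs \<in> ham_orderings V E. hd xs = i}"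
proof -
  let ?H = "ham_orderings V E" and ?R = "rotation_rel (ham_orderings V E)"
  let ?B = "{xs \<in> ?H. hd xs = i}"
  have "bij_betw (\<lambda>xs. ?R `` {xs}) ?B (?H // ?R)"
    unfolding bij_betw_def
  proof
    show "inj_on (\<lambda>xs. ?R `` {xs}) ?B"
    proof (rule inj_onI)
      fix xs ys assume *: "xs \<in> ?B" "ys \<in> ?B" "?R `` {xs} = ?R `` {ys}"
      then have "(xs, ys) \<in> ?R"
        using eq_equiv_class[OF _ equiv_rotation_rel] by blast
      then obtain m where m: "ys = rotate m xs" by (auto simp: rotation_rel_def)
      have ne: "xs \<noteq> []" and d: "distinct xs"
        using * assms by (auto simp: ham_orderings_def)
      \<comment> \<open>Both lists start at \<open>i\<close>; as the entries are distinct, the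
        rotation between them is trivial.\<close>
      have "xs ! (m mod length xs) = xs ! 0"
        using * m hd_rotate_conv_nth[OF ne, of m] hd_conv_nth[OF ne] by simp
      then have "m mod length xs = 0"
        using d ne by (simp add: nth_eq_iff_index_eq)
      then show "xs = ys" using m by (metis rotate0 id_apply rotate_conv_mod)
    qed
    show "(\<lambda>xs. ?R `` {xs}) ` ?B = ?H // ?R"
    proof
      show "(\<lambda>xs. ?R `` {xs}) ` ?B \<subseteq> ?H // ?R" by (auto intro: quotientI)
      show "?H // ?R \<subseteq> (\<lambda>xs. ?R `` {xs}) ` ?B"
      proof
        fix C assume "C \<in> ?H // ?R"
        then obtain xs where xs: "xs \<in> ?H" "C = ?R `` {xs}" by (auto elim: quotientE)
        then have "i \<in> set xs" using assms by (simp add: ham_orderings_def)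
        then obtain m where m: "m < length xs" "xs ! m = i" by (auto simp: in_set_conv_nth)
        then have "hd (rotate m xs) = i"
          by (subst hd_rotate_conv_nth) auto
        moreover have rot: "rotate m xs \<in> ?H" using xs by (simp add: rotate_ham_orderings)
        moreover have "(xs, rotate m xs) \<in> ?R"
          using xs rot by (auto simp: rotation_rel_def)
        then have "C = ?R `` {rotate m xs}"
          using xs equiv_class_eq[OF equiv_rotation_rel] by blast
        ultimately show "C \<in> (\<lambda>xs. ?R `` {xs}) ` ?B" by blast
      qed
    qed
  qed
  then show ?thesis
    unfolding ham_cycle_count_def by (simp add: bij_betw_same_card)
qed

section \<open>Specialization to the graph Laplacian\<close>

text \<open>The sign is moved into the weights so that off the diagonal they are the adjacency
  entries.\<close>

lemma graph_poly_eq: "graph_poly E = det (mat 1 - weighted_matrix (- laplacian E))"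
  unfolding graph_poly_def
  by (rule arg_cong[of _ _ det])
    (simp add: vec_eq_iff D_matrix_def weighted_matrix_def matrix_matrix_mult_def
      if_distrib[of "\<lambda>x. x * _"] cong: if_cong)

lemma laplacian_diag: "irreflp E \<Longrightarrow> laplacian E $ i $ i = real (graph_degree E i)"
  by (simp add: laplacian_def degree_matrix_def adjacency_matrix_def irreflp_def)

lemma laplacian_offdiag: "i \<noteq> j \<Longrightarrow> laplacian E $ i $ j = (if E i j then - 1 else 0)"
  by (simp add: laplacian_def degree_matrix_def adjacency_matrix_def)

lemma kappa_eq:
  "i \<in> S \<Longrightarrow> kappa E S = - (\<Sum>xs\<in>orderings_from S i. walk_weight (- laplacian E) xs i)"
  unfolding kappa_def graph_poly_eq by (rule sq_coeff_log_det_weighted)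

text \<open>With at least two vertices, cyclically consecutive ones differ, so no diagonal entry
  occurs and the weight is a product of edge indicators.\<close>

lemma walk_weight_laplacian_cycle:
  assumes "xs \<in> orderings_from S i" "card S \<ge> 2"
  shows "walk_weight (- laplacian E) xs i =
    (if xs \<in> ham_orderings S (induced_subgraph E S) then 1 else 0)"
proof -
  let ?n = "length xs"
  have xs: "distinct xs" "set xs = S" "xs \<noteq> []" "hd xs = i" and n: "?n \<ge> 2"
    using assms distinct_card[of xs] by (auto simp: orderings_from_def)
  have "(- laplacian E) $ (xs ! r) $ ((xs @ [i]) ! Suc r) =
      (if induced_subgraph E S (xs ! r) (xs ! (Suc r mod ?n)) then 1 else 0)" if r: "r < ?n" for r
  proof -
    \<comment> \<open>The appended \<open>i\<close> equals \<open>hd xs\<close>, so it is the cyclic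
      successor of the last vertex.\<close>
    have nxt: "(xs @ [i]) ! Suc r = xs ! (Suc r mod ?n)"
    proof (cases "Suc r = ?n")
      case True
      then show ?thesis using xs by (simp add: nth_append hd_conv_nth)
    next
      case False
      then show ?thesis using r by (simp add: nth_append)
    qed
    have lt: "Suc r mod ?n < ?n" by (rule mod_less_divisor) (use n in linarith)
    have "r \<noteq> Suc r mod ?n" using r n by (cases "Suc r = ?n") auto
    then have "xs ! r \<noteq> xs ! (Suc r mod ?n)"
      using xs(1) r lt by (simp add: nth_eq_iff_index_eq)
    moreover have "xs ! r \<in> S" "xs ! (Suc r mod ?n) \<in> S"
      using xs(2) r lt nth_mem by blast+
    ultimately show ?thesis
      unfolding nxt by (simp add: laplacian_offdiag induced_subgraph_def)
  qed
  then have "walk_weight (- laplacian E) xs i =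
      (\<Prod>r<?n. if induced_subgraph E S (xs ! r) (xs ! (Suc r mod ?n)) then 1 else 0)"
    unfolding walk_weight_def by (intro prod.cong) auto
  also have "\<dots> = (if xs \<in> ham_orderings S (induced_subgraph E S) then 1 else 0)"
    using xs by (auto simp: ham_orderings_def)
  finally show ?thesis .
qed

text \<open>Fixing a base vertex \<open>i\<close> of \<open>S\<close>, the walk sum counts the
  Hamiltonian orderings starting at \<open>i\<close>, one for each rotation class.\<close>

lemma kappa_eq_ham_cycle_count:
  assumes "card S \<ge> 2"
  shows "kappa E S = - real (ham_cycle_count S (induced_subgraph E S))"
proof -
  from assms have "S \<noteq> {}" by auto
  then obtain i where i: "i \<in> S" by blast
  let ?H = "ham_orderings S (induced_subgraph E S)"
  have "orderings_from S i \<inter> ?H = {xs \<in> ?H. hd xs = i}"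
    using i by (auto simp: orderings_from_def ham_orderings_def)
  then show ?thesis
    using i assms
    by (simp add: kappa_eq walk_weight_laplacian_cycle sum.If_cases finite_orderings_from
        ham_cycle_count_eq)
qed

lemma orderings_from_doubleton: "i \<noteq> j \<Longrightarrow> orderings_from {i, j} i = {[i, j]}"
proof
  assume ne: "i \<noteq> j"
  show "orderings_from {i, j} i \<subseteq> {[i, j]}"
  proof
    fix xs assume xs: "xs \<in> orderings_from {i, j} i"
    then obtain ys where ys: "xs = i # ys" by (cases xs) (auto simp: orderings_from_def)
    have "ys \<in> orderings_from {j} j"
      using xs ne ys by (cases ys) (auto simp: orderings_from_def)
    then show "xs \<in> {[i, j]}" by (simp add: ys orderings_from_singleton)
  qed
qed (auto simp: orderings_from_def)

theorem theorem6p5: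
  fixes E :: "'n::finite \<Rightarrow> 'n \<Rightarrow> bool"
  assumes "simple_graph E"
  shows "sq_coeff (graph_poly E) {} = 1 \<and>
    sq_log (graph_poly E) = (\<Sum>S | S \<noteq> {}. kappa E S *\<^sub>R tmon S) \<and>
    (\<forall>i. kappa E {i} = real (graph_degree E i)) \<and>
    (\<forall>S. card S \<ge> 2 \<longrightarrow>
       kappa E S = - real (ham_cycle_count S (induced_subgraph E S))) \<and>
    (\<forall>i j. i \<noteq> j \<longrightarrow> kappa E {i, j} = (if E i j then - 1 else 0)) \<and>
    (\<forall>S. card S \<ge> 2 \<longrightarrow> kappa E S \<le> 0)"
proof (intro conjI allI impI)
  show f0: "sq_coeff (graph_poly E) {} = 1"
    by (simp add: graph_poly_eq det_weighted_sq_coeff_empty)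
  have "kappa E {} = 0"
    unfolding kappa_def using f0 by (rule sq_coeff_log_empty)
  then have "(\<Sum>S\<in>UNIV. kappa E S *\<^sub>R tmon S) = (\<Sum>S | S \<noteq> {}. kappa E S *\<^sub>R tmon S)"
    by (intro sum.mono_neutral_right) auto
  then show "sq_log (graph_poly E) = (\<Sum>S | S \<noteq> {}. kappa E S *\<^sub>R tmon S)"
    using sqalg_expand[of "sq_log (graph_poly E)"] by (simp add: kappa_def)
  \<comment> \<open>The only walk is the loop at \<open>i\<close>, of weight minus the
    degree.\<close>
  show "kappa E {i} = real (graph_degree E i)" for i
    using assms
    by (simp add: kappa_eq orderings_from_singleton walk_weight_def laplacian_diag simple_graph_def)
  show "kappa E S = - real (ham_cycle_count S (induced_subgraph E S))" if "card S \<ge> 2" for S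
    using that by (rule kappa_eq_ham_cycle_count)
  show "kappa E {i, j} = (if E i j then - 1 else 0)" if "i \<noteq> j" for i j
  proof -
    \<comment> \<open>The closed walk through \<open>i\<close> and \<open>j\<close> uses the edge in
      both directions.\<close>
    have "E i j \<longleftrightarrow> E j i" using assms by (auto simp: simple_graph_def dest: sympD)
    then show ?thesis
      using that by (simp add: kappa_eq[of i] orderings_from_doubleton walk_weight_Cons
          laplacian_offdiag) (simp add: walk_weight_def)
  qed
  show "kappa E S \<le> 0" if "card S \<ge> 2" for S
    using that by (simp add: kappa_eq_ham_cycle_count)
qed

end
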